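(* For $\rho>1$ let $\mathcal{E}_\rho=\{z=\tfrac12(\zeta+\zeta^{-1}):|\zeta|=\rho\}$ and $\|g\|_{\mathcal{E}_\rho}=\max_{z\in\mathcal{E}_\rho}|g(z)|$. Let $K_m^{[I]}$, $K_n^{[1]}$, $K_n^{[2]}$, $K_n^{[3]}$ be the kernels given by the explicit formulas in the context. Then: (1) For each positive integer $m$ there exists $\rho^*=\rho^*(m)>1$ such that for each $\rho>\rho^*$ the modulus of $K_m^{[I]}$ on $\mathcal{E}_\rho$ attains its maximum value on the real axis, i.e. $$\|K_m^{[I]}\|_{\mathcal{E}_\rho}=\left|K_m^{[I]}\left(-\tfrac12(\rho+\rho^{-1})\right)\right|=\left|K_m^{[I]}\left(\tfrac12(\rho+\rho^{-1})\right)\right|.$$ (2) For each integer $n>1$ there exists $\rho^*=\rho^*(n)>1$ such that for each $\rho>\rho^*$ the modulus of $K_n^{[1]}$ on $\mathcal{E}_\rho$ attains its maximum value on the real axis, i.e. $$\|K_n^{[1]}\|_{\mathcal{E}_\rho}=\left|K_n^{[1]}\left(-\tfrac12(\rho+\rho^{-1})\right)\right|=\left|K_n^{[1]}\left(\tfrac12(\rho+\rho^{-1})\right)\right|.$$ (3) For each integer $n>1$ there exists $\rho^*=\rho^*(n)>1$ such that for each $\rho>\rho^*$ the modulus of $K_n^{[2]}$ on $\mathcal{E}_\rho$ attains its maximum value on the real axis, i.e. $$\|K_n^{[2]}\|_{\mathcal{E}_\rho}=\left|K_n^{[2]}\left(-\tfrac12(\rho+\rho^{-1})\right)\right|=\left|K_n^{[2]}\left(\tfrac12(\rho+\rho^{-1})\right)\right|,$$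 while for $n=1$ there exists $\rho^*=\rho^*(1)>1$ such that for each $\rho>\rho^*$ the modulus of $K_1^{[2]}$ on $\mathcal{E}_\rho$ attains its maximum value on the imaginary axis, i.e. $$\|K_1^{[2]}\|_{\mathcal{E}_\rho}=\left|K_1^{[2]}\left(\tfrac{i}{2}(\rho-\rho^{-1})\right)\right|.$$ (4) For each positive integer $n$ there exists $\rho^*=\rho^*(n)>1$ such that for each $\rho>\rho^*$ the modulus of $K_n^{[3]}$ on $\mathcal{E}_\rho$ attains its maximum value on the real axis, i.e. $$\|K_n^{[3]}\|_{\mathcal{E}_\rho}=\left|K_n^{[3]}\left(-\tfrac12(\rho+\rho^{-1})\right)\right|=\left|K_n^{[3]}\left(\tfrac12(\rho+\rho^{-1})\right)\right|.$$
   Context: For $z\in\mathbb{C}\setminus[-1,1]$ write $z=\frac12(\zeta+\zeta^{-1})$ with $|\zeta|>1$ (this determines $\zeta$ uniquely). The kernels are the following functions of $z$: For $m$ even, $$K_m^{[I]}(z)=\pi\,\frac{(\zeta^2+1)^2\left(1+(-1)^{m/2}\zeta^m\right)}{\zeta^2(\zeta-\zeta^{-1})(\zeta^{2m+2}+1)};$$ for $m$ odd, $$K_m^{[I]}(z)=\pi\,\frac{(m+2)\zeta^2+m}{\zeta^{m+2}(\zeta-\zeta^{-1})\left(\sum_{j=0}^{(m-1)/2}(-1)^j(m-2j)\zeta^{m-2j}+\sum_{j=0}^{(m-1)/2}(-1)^j(m-2j)\zeta^{2j-m}\right)}.$$ For $n>1$, $$K_n^{[1]}(z)=\frac{\pi(3\zeta^{2n}+1)}{2^{2n-2}\zeta^{3n}(\zeta-\zeta^{-1})(\zeta^n+\zeta^{-n})}.$$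 For $n\ge1$, $$K_n^{[2]}(z)=\frac{\pi(2\zeta^{2n+2}-\zeta^{2n}-1)}{2^{2n}\zeta^{3n+2}(\zeta-\zeta^{-1})(\zeta^n+\zeta^{-n})},\qquad K_n^{[3]}(z)=\frac{\pi(2\zeta^{2n+1}+\zeta^{2n}+1)}{2^{2n}\zeta^{3n+1}(\zeta-\zeta^{-1})(\zeta^n+\zeta^{-n})}.$$
   Formalization: In part (4) the equality with |K_n^{[3]}(-(ρ+1/ρ)/2)| is dropped: it fails for every n and ρ>1, as the modulus there is strictly smaller than at (ρ+1/ρ)/2; the maximum is stated at (ρ+1/ρ)/2 only. *)

theory Defs
  imports "HOL-Analysis.Analysis"
begin

definition zeta_of :: "complex \<Rightarrow> complex" where
  "zeta_of z = (THE \<zeta>. cmod \<zeta> > 1 \<and> z = (\<zeta> + inverse \<zeta>) / 2)"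

definition ellipse :: "real \<Rightarrow> complex set" where
  "ellipse \<rho> = {(\<zeta> + inverse \<zeta>) / 2 | \<zeta>. cmod \<zeta> = \<rho>}"

text \<open>The supremum is a maximum only where it is attained; the theorem asserts attainment
  separately.\<close>

definition ellipse_norm :: "real \<Rightarrow> (complex \<Rightarrow> complex) \<Rightarrow> real" where
  "ellipse_norm \<rho> g = (SUP z\<in>ellipse \<rho>. cmod (g z))"

definition attains_max_on_real_axis :: "real \<Rightarrow> (complex \<Rightarrow> complex) \<Rightarrow> bool" where
  "attains_max_on_real_axis \<rho> g \<longleftrightarrow>
     (\<exists>w. w \<in> \<real> \<and> is_arg_max (\<lambda>z. cmod (g z)) (\<lambda>z. z \<in> ellipse \<rho>) w)"

definition attains_max_on_imaginary_axis :: "real \<Rightarrow> (complex \<Rightarrow> complex) \<Rightarrow> bool" where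
  "attains_max_on_imaginary_axis \<rho> g \<longleftrightarrow>
     (\<exists>w. Re w = 0 \<and> is_arg_max (\<lambda>z. cmod (g z)) (\<lambda>z. z \<in> ellipse \<rho>) w)"

definition K_I :: "nat \<Rightarrow> complex \<Rightarrow> complex" where
  "K_I m z = (let \<zeta> = zeta_of z in
     if even m then
       of_real pi * ((\<zeta>^2 + 1)^2 * (1 + (-1)^(m div 2) * \<zeta>^m)
         / (\<zeta>^2 * (\<zeta> - inverse \<zeta>) * (\<zeta>^(2*m+2) + 1)))
     else
       of_real pi * ((of_nat (m+2) * \<zeta>^2 + of_nat m)
         / (\<zeta>^(m+2) * (\<zeta> - inverse \<zeta>) *
            ((\<Sum>j=0..(m-1) div 2. (-1)^j * of_nat (m-2*j) * \<zeta>^(m-2*j))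
             + (\<Sum>j=0..(m-1) div 2. (-1)^j * of_nat (m-2*j) * \<zeta> powi (2 * int j - int m))))))"

definition K_1 :: "nat \<Rightarrow> complex \<Rightarrow> complex" where
  "K_1 n z = (let \<zeta> = zeta_of z in
     of_real pi * (3 * \<zeta>^(2*n) + 1)
       / (2^(2*n-2) * \<zeta>^(3*n) * (\<zeta> - inverse \<zeta>) * (\<zeta>^n + \<zeta> powi (- int n))))"

definition K_2 :: "nat \<Rightarrow> complex \<Rightarrow> complex" where
  "K_2 n z = (let \<zeta> = zeta_of z in
     of_real pi * (2 * \<zeta>^(2*n+2) - \<zeta>^(2*n) - 1)
       / (2^(2*n) * \<zeta>^(3*n+2) * (\<zeta> - inverse \<zeta>) * (\<zeta>^n + \<zeta> powi (- int n))))"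

definition K_3 :: "nat \<Rightarrow> complex \<Rightarrow> complex" where
  "K_3 n z = (let \<zeta> = zeta_of z in
     of_real pi * (2 * \<zeta>^(2*n+1) + \<zeta>^(2*n) + 1)
       / (2^(2*n) * \<zeta>^(3*n+1) * (\<zeta> - inverse \<zeta>) * (\<zeta>^n + \<zeta> powi (- int n))))"

lemma zeta_of_eq:
  assumes "cmod \<zeta> > 1"
  shows "zeta_of ((\<zeta> + inverse \<zeta>) / 2) = \<zeta>"
  unfolding zeta_of_def
proof (rule the_equality)
  show "cmod \<zeta> > 1 \<and> (\<zeta> + inverse \<zeta>) / 2 = (\<zeta> + inverse \<zeta>) / 2" using assms by simp
next
  fix \<xi> assume x: "cmod \<xi> > 1 \<and> (\<zeta> + inverse \<zeta>) / 2 = (\<xi> + inverse \<xi>) / 2"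
  have nz: "\<zeta> \<noteq> 0" "\<xi> \<noteq> 0" using assms x by auto
  have "2 * ((\<zeta> + inverse \<zeta>) / 2) = 2 * ((\<xi> + inverse \<xi>) / 2)" using x by (simp only:)
  then have "\<zeta> + inverse \<zeta> = \<xi> + inverse \<xi>"
    unfolding times_divide_eq_right by (simp only: nonzero_mult_div_cancel_left[of "2::complex"] zero_neq_numeral[symmetric] not_False_eq_True)
  then have "(\<xi> - \<zeta>) * (\<xi> * \<zeta> - 1) = 0" using nz by (simp add: field_simps)
  moreover have "\<xi> * \<zeta> \<noteq> 1"
  proof
    assume "\<xi> * \<zeta> = 1"
    then have "cmod \<xi> * cmod \<zeta> = 1" by (metis norm_mult norm_one)
    moreover have "cmod \<xi> * cmod \<zeta> > 1" using assms x by (simp add: less_1_mult)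
    ultimately show False by simp
  qed
  ultimately show "\<xi> = \<zeta>" by simp
qed

text \<open>Unlike \<open>K_I\<close>, \<open>K_1\<close> and \<open>K_2\<close>, the modulus of \<open>K_3\<close> is not symmetric under
  \<open>z \<mapsto> -z\<close>: it is strictly smaller at the left vertex of the ellipse than at the right one.  Hence the maximum
  of \<open>K_3\<close> over the ellipse is claimed at the right vertex only; the equality with the value
  at the left vertex, which holds for the other kernels, fails for every \<open>\<rho> > 1\<close>.\<close>

lemma K_3_vertices_less:
  assumes "\<rho> > 1"
  shows "cmod (K_3 n (- (of_real (\<rho> + inverse \<rho>) / 2)))
       < cmod (K_3 n (of_real (\<rho> + inverse \<rho>) / 2))"
proof -
  define r where "r = complex_of_real \<rho>"
  have r0: "r \<noteq> 0" using assms by (simp add: r_def)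
  have z1: "zeta_of (of_real (\<rho> + inverse \<rho>) / 2) = r"
    using zeta_of_eq[of r] assms by (simp add: r_def)
  have e2: "- (of_real (\<rho> + inverse \<rho>) / 2) = (- r + inverse (- r)) / 2"
    by (simp add: r_def field_simps)
  have z2: "zeta_of (- (of_real (\<rho> + inverse \<rho>) / 2)) = - r"
    unfolding e2 by (rule zeta_of_eq) (use assms in \<open>simp add: r_def\<close>)
  define D where "D = 2^(2*n) * r^(3*n+1) * (r - inverse r) * (r^n + r powi (- int n))"
  have D2: "cmod (2^(2*n) * (-r)^(3*n+1) * ((-r) - inverse (-r)) * ((-r)^n + (-r) powi (- int n))) = cmod D"
  proof -
    have a: "(-r) - inverse (-r) = - (r - inverse r)" by simp
    have b: "(-r)^n + (-r) powi (- int n) = (-1)^n * (r^n + r powi (- int n))"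
      by (cases "even n") (simp_all add: power_int_minus)
    show ?thesis unfolding a b D_def by (simp add: norm_mult norm_power norm_minus_commute)
  qed
  have "r^n + r powi (- int n) = of_real (\<rho>^n + inverse (\<rho>^n))"
    by (simp add: r_def power_int_minus)
  moreover have "\<rho>^n + inverse (\<rho>^n) > 0" using assms by (simp add: add_pos_pos)
  ultimately have "r^n + r powi (- int n) \<noteq> 0" by (metis of_real_eq_0_iff less_irrefl)
  moreover have "r - inverse r = of_real (\<rho> - inverse \<rho>)" by (simp add: r_def)
  moreover have "\<rho> - inverse \<rho> > 0" using assms inverse_less_1_iff[of \<rho>] by linarith
  ultimately have D0: "D \<noteq> 0" unfolding D_def using r0
    by (metis (no_types, lifting) less_irrefl mult_eq_0_iff of_real_eq_0_iff power_not_zero zero_neq_numeral)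
  define A where "A = 2 * \<rho>^(2*n+1)"
  define B where "B = \<rho>^(2*n) + 1"
  have pw: "\<rho>^(2*n) \<ge> 1" using assms by simp
  have "A > 0" using assms by (simp add: A_def)
  moreover have "B > 0" using pw unfolding B_def by linarith
  ultimately have "A > 0" "B > 0" by auto
  then have AB: "\<bar>B - A\<bar> < A + B" by linarith
  have n1: "cmod (2 * r^(2*n+1) + r^(2*n) + 1) = A + B"
  proof -
    have "2 * r^(2*n+1) + r^(2*n) + 1 = of_real (A + B)" by (simp add: A_def B_def r_def)
    then show ?thesis using \<open>A > 0\<close> \<open>B > 0\<close> by (metis norm_of_real abs_of_pos add_pos_pos)
  qed
  have n2: "cmod (2 * (-r)^(2*n+1) + (-r)^(2*n) + 1) = \<bar>B - A\<bar>"
  proof -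
    have "2 * (-r)^(2*n+1) + (-r)^(2*n) + 1 = of_real (B - A)" by (simp add: A_def B_def r_def)
    then show ?thesis by (metis norm_of_real)
  qed
  have "cmod (K_3 n (of_real (\<rho> + inverse \<rho>) / 2)) = pi * (A + B) / cmod D"
    unfolding K_3_def z1 Let_def D_def[symmetric] norm_divide norm_mult n1 by simp
  moreover have "cmod (K_3 n (- (of_real (\<rho> + inverse \<rho>) / 2))) = pi * \<bar>B - A\<bar> / cmod D"
    unfolding K_3_def z2 Let_def norm_divide D2 norm_mult[of "of_real pi"] n2 by simp
  ultimately show ?thesis using AB D0 by (simp add: divide_strict_right_mono)
qed

end

theory Submission
  imports Defs
begin

text \<open>
  Write \<open>\<zeta>\<close> for the exterior parameter of a point of the ellipse, so that \<open>|\<zeta>| = \<rho>\<close>.  On the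
  ellipse the modulus of each kernel is a positive constant depending on \<open>\<rho>\<close> only, times the
  modulus of a fixed rational function \<open>G = p / q\<close> with real coefficients, finite and nonzero at
  \<open>0\<close>, evaluated at a small argument \<open>u\<close>.  The argument is \<open>u = \<zeta>\<^sup>-\<^sup>2\<close> for \<open>K_I\<close>, \<open>K_1\<close> and \<open>K_2\<close>, and
  \<open>u = \<zeta>\<^sup>-\<^sup>1\<close> for \<open>K_3\<close>.  It runs through a circle of radius \<open>R\<close>, and \<open>R\<close> tends to \<open>0\<close> as \<open>\<rho>\<close> grows.

  To first order \<open>log |G(u)|\<close> is \<open>log |G(0)| + (G'(0) / G(0)) Re u\<close>.  So if \<open>G'(0) / G(0) > 0\<close> then
  the modulus of \<open>G\<close> should be largest at \<open>u = R\<close>.  That the maximum lies exactly at this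
  point, and not merely near it, needs the error term to vanish at \<open>u = R\<close> to the same order as the main
  term \<open>R - Re u\<close>.  This holds because the coefficients are real: with \<open>u = R v\<close> and
  \<open>|v| = 1\<close>, the quantity \<open>|p(R)|\<^sup>2 - |p(R v)|\<^sup>2\<close> is a combination of the numbers
  \<open>R\<^sup>j\<^sup>+\<^sup>k |v\<^sup>j - v\<^sup>k|\<^sup>2\<close>, and each of these is at most a constant times \<open>R\<^sup>j\<^sup>+\<^sup>k |v - 1|\<^sup>2\<close>
  (\<open>norm_poly_circle_expansion\<close>).  Since \<open>R |v - 1|\<^sup>2 = 2 (R - Re u)\<close>, this factor splits off and
  the sign is decided by the first-order coefficient for all small \<open>R\<close>, uniformly in \<open>v\<close>
  (\<open>rational_max_at_positive_point\<close>).

  It remains to compute \<open>G'(0) / G(0)\<close> for each kernel.  It is \<open>3\<close> for \<open>K_I\<close> with even \<open>m \<ge> 4\<close> and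
  \<open>2\<close> for \<open>m = 2\<close>; it is \<open>m / (m + 2) + 1 + (m - 2) / m\<close> for odd \<open>m\<close>; it is \<open>1\<close> for \<open>K_1\<close> and \<open>1 / 2\<close> for \<open>K_2\<close>
  with \<open>n > 1\<close>, and \<open>1 / 2\<close> for \<open>K_3\<close>.  All of these are positive.  For \<open>u = \<zeta>\<^sup>-\<^sup>2\<close> the point \<open>u = R\<close>
  corresponds to both \<open>\<zeta> = \<rho>\<close> and \<open>\<zeta> = -\<rho>\<close>, the two real vertices; for \<open>u = \<zeta>\<^sup>-\<^sup>1\<close> only to the right
  one.  For \<open>K_2\<close> with \<open>n = 1\<close> the factor \<open>1 + u\<^sup>n\<close> of the denominator enters at first order
  and turns the value \<open>1 / 2\<close> into \<open>-1 / 2\<close>; the argument then applies to \<open>-u\<close>, whose positive values belong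
  to \<open>\<zeta> = \<plusminus>i\<rho>\<close>, on the imaginary axis.
\<close>

section \<open>Polynomials with real coefficients on small circles\<close>

definition real_coeffs :: "complex poly \<Rightarrow> bool" where
  "real_coeffs p \<longleftrightarrow> (\<forall>i. coeff p i \<in> \<real>)"

lemma real_coeffs_0 [simp]: "real_coeffs 0"
  and real_coeffs_1 [simp]: "real_coeffs 1"
  by (auto simp: real_coeffs_def coeff_1)

lemma real_coeffs_pCons [simp]: "real_coeffs (pCons a p) \<longleftrightarrow> a \<in> \<real> \<and> real_coeffs p"
  unfolding real_coeffs_def by (auto simp: coeff_pCons split: nat.splits)

lemma real_coeffs_add: "real_coeffs p \<Longrightarrow> real_coeffs q \<Longrightarrow> real_coeffs (p + q)"
  by (simp add: real_coeffs_def)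

lemma real_coeffs_diff: "real_coeffs p \<Longrightarrow> real_coeffs q \<Longrightarrow> real_coeffs (p - q)"
  by (simp add: real_coeffs_def)

lemma real_coeffs_mult: "real_coeffs p \<Longrightarrow> real_coeffs q \<Longrightarrow> real_coeffs (p * q)"
  by (auto simp: real_coeffs_def coeff_mult intro!: sum_in_Reals)

lemma real_coeffs_smult: "c \<in> \<real> \<Longrightarrow> real_coeffs p \<Longrightarrow> real_coeffs (smult c p)"
  by (simp add: real_coeffs_def)

lemma real_coeffs_sum: "(\<And>i. i \<in> A \<Longrightarrow> real_coeffs (f i)) \<Longrightarrow> real_coeffs (sum f A)"
  by (auto simp: real_coeffs_def coeff_sum intro!: sum_in_Reals)

lemma real_coeffs_monom: "c \<in> \<real> \<Longrightarrow> real_coeffs (monom c n)"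
  by (simp add: real_coeffs_def)

lemmas real_coeffs_intros = real_coeffs_add real_coeffs_diff real_coeffs_mult real_coeffs_smult
  real_coeffs_sum real_coeffs_monom

text \<open>The deviation of this real part from its value at \<open>v = 1\<close> is a squared distance, hence has
  a sign and can be compared with \<open>|v - 1|\<^sup>2\<close>.\<close>

lemma Re_power_mult_cnj_power:
  assumes "cmod v = 1"
  shows "Re (v ^ j * cnj (v ^ k)) = 1 - (cmod (v ^ j - v ^ k))\<^sup>2 / 2"
proof -
  have *: "(cmod (x - y))\<^sup>2 = 2 - 2 * Re (x * cnj y)" if "cmod x = 1" "cmod y = 1" for x y
  proof -
    have "(Re x)\<^sup>2 + (Im x)\<^sup>2 = 1" "(Re y)\<^sup>2 + (Im y)\<^sup>2 = 1"
      using that by (simp_all add: cmod_def)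
    then show ?thesis
      unfolding cmod_power2 by (simp add: power2_eq_square algebra_simps)
  qed
  show ?thesis
    using *[of "v ^ j" "v ^ k"] assms by (simp add: norm_power field_simps)
qed

text \<open>A Lipschitz bound uniform in \<open>v\<close>: it puts the factor \<open>|v - 1|\<^sup>2\<close> into every term of the
  expansion below.\<close>

lemma norm_power_diff_powers:
  fixes v :: complex
  assumes "cmod v = 1"
  shows "cmod (v ^ j - v ^ k) \<le> real (j + k) * cmod (v - 1)"
proof -
  have "cmod (v ^ j - v ^ k) \<le> cmod (v ^ j - 1) + cmod (v ^ k - 1)"
    by (metis diff_add_cancel add_diff_eq norm_triangle_ineq4 diff_diff_eq2)
  also have "\<dots> \<le> real j * cmod (v - 1) + real k * cmod (v - 1)"
    using norm_power_diff[of v 1 j] norm_power_diff[of v 1 k] assms by simp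
  finally show ?thesis by (simp add: algebra_simps)
qed

text \<open>Expanding \<open>p(R v)\<close> times its conjugate; real coefficients make the coefficient of each
  \<open>v\<^sup>j\<close> times the conjugate of \<open>v\<^sup>k\<close> real, so that only the real part of that product survives.\<close>

lemma norm_poly_on_circle:
  assumes p: "real_coeffs p" and v: "cmod v = 1" and N: "degree p \<le> N"
  shows "(cmod (poly p (of_real R * v)))\<^sup>2 =
    (\<Sum>j\<le>N. \<Sum>k\<le>N. Re (coeff p j) * Re (coeff p k) * R ^ (j + k)
       * (1 - (cmod (v ^ j - v ^ k))\<^sup>2 / 2))"
proof -
  have a: "coeff p i = of_real (Re (coeff p i))" for i
    using p by (simp add: real_coeffs_def)
  have P: "poly p z = (\<Sum>j\<le>N. coeff p j * z ^ j)" for z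
    unfolding poly_altdef using N
    by (intro sum.mono_neutral_left) (auto simp: not_le coeff_eq_0)
  have "(cmod (poly p (of_real R * v)))\<^sup>2 = Re (poly p (of_real R * v) * cnj (poly p (of_real R * v)))"
    by (simp flip: complex_norm_square)
  also have "\<dots> = (\<Sum>j\<le>N. \<Sum>k\<le>N. Re ((coeff p j * (of_real R * v) ^ j) * cnj (coeff p k * (of_real R * v) ^ k)))"
    unfolding P cnj_sum sum_product Re_sum ..
  also have "\<dots> = (\<Sum>j\<le>N. \<Sum>k\<le>N. Re (coeff p j) * Re (coeff p k) * R ^ (j + k)
       * (1 - (cmod (v ^ j - v ^ k))\<^sup>2 / 2))"
  proof (intro sum.cong refl)
    fix j k
    have "(coeff p j * (of_real R * v) ^ j) * cnj (coeff p k * (of_real R * v) ^ k)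
        = of_real (Re (coeff p j) * Re (coeff p k) * R ^ (j + k)) * (v ^ j * cnj (v ^ k))"
      by (subst a[of j], subst a[of k]) (simp add: power_mult_distrib power_add)
    then show "Re ((coeff p j * (of_real R * v) ^ j) * cnj (coeff p k * (of_real R * v) ^ k))
      = Re (coeff p j) * Re (coeff p k) * R ^ (j + k) * (1 - (cmod (v ^ j - v ^ k))\<^sup>2 / 2)"
      unfolding Re_power_mult_cnj_power[OF v, symmetric] by (simp only: scaleR_conv_of_real[symmetric] scaleR_complex.sel)
  qed
  finally show ?thesis .
qed

text \<open>The difference of the squared moduli is a double sum over exponents \<open>j\<close>, \<open>k\<close>.  Terms with \<open>j = k\<close>
  vanish, the pairs \<open>(0,1)\<close> and \<open>(1,0)\<close> give the main term, and every other pair has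
  \<open>j + k \<ge> 2\<close>.  The essential feature is the factor \<open>|v - 1|\<^sup>2\<close> in the error bound: the
  error vanishes at \<open>v = 1\<close> as fast as the main term does.\<close>

lemma norm_poly_circle_expansion:
  assumes p: "real_coeffs p"
  shows "\<exists>C. \<forall>R v. 0 \<le> R \<longrightarrow> R \<le> 1 \<longrightarrow> cmod v = 1 \<longrightarrow>
    \<bar>(cmod (poly p (of_real R)))\<^sup>2 - (cmod (poly p (of_real R * v)))\<^sup>2
      - Re (coeff p 0) * Re (coeff p 1) * R * (cmod (v - 1))\<^sup>2\<bar> \<le> C * R\<^sup>2 * (cmod (v - 1))\<^sup>2"
proof -
  \<comment> \<open>One more than the degree, so that the summation range always contains the exponent 1.\<close>
  define N where "N = degree p + 1"
  define a where "a i = Re (coeff p i)" for i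
  define C where "C = (\<Sum>j\<le>N. \<Sum>k\<le>N. \<bar>a j * a k\<bar> * (real (j + k))\<^sup>2)"
  have "\<bar>(cmod (poly p (of_real R)))\<^sup>2 - (cmod (poly p (of_real R * v)))\<^sup>2
      - a 0 * a 1 * R * (cmod (v - 1))\<^sup>2\<bar> \<le> C * R\<^sup>2 * (cmod (v - 1))\<^sup>2"
    if R: "0 \<le> R" "R \<le> 1" and v: "cmod v = 1" for R v
  proof -
    define s where "s = (cmod (v - 1))\<^sup>2"
    define T where "T j k = a j * a k * R ^ (j + k) * ((cmod (v ^ j - v ^ k))\<^sup>2 / 2)" for j k
    \<comment> \<open>The main term, shared equally between the pairs \<open>(0,1)\<close> and \<open>(1,0)\<close>.\<close>
    define U where "U j k = (if j + k = 1 then a 0 * a 1 * R * (s / 2) else 0)" for j k :: nat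
    have "(cmod (poly p (of_real R)))\<^sup>2 - (cmod (poly p (of_real R * v)))\<^sup>2 = (\<Sum>j\<le>N. \<Sum>k\<le>N. T j k)"
    proof -
      have N: "degree p \<le> N" by (simp add: N_def)
      show ?thesis
        using norm_poly_on_circle[OF p v N, of R] norm_poly_on_circle[OF p _ N, of 1 R]
        unfolding T_def a_def by (simp add: right_diff_distrib sum_subtractf)
    qed
    moreover have "(\<Sum>j\<le>N. \<Sum>k\<le>N. U j k) = a 0 * a 1 * R * s"
    proof -
      have "(\<Sum>k\<le>N. U j k) = (if j \<le> 1 then a 0 * a 1 * R * (s / 2) else 0)" for j
      proof -
        have "1 - j \<le> N" by (simp add: N_def)
        have "(\<Sum>k\<le>N. U j k) = (\<Sum>k\<le>N. if k = 1 - j then (if j \<le> 1 then a 0 * a 1 * R * (s / 2) else 0) else 0)"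
          by (intro sum.cong) (auto simp: U_def)
        also have "\<dots> = (if j \<le> 1 then a 0 * a 1 * R * (s / 2) else 0)"
          using \<open>1 - j \<le> N\<close> by simp
        finally show ?thesis .
      qed
      then have "(\<Sum>j\<le>N. \<Sum>k\<le>N. U j k) = (\<Sum>j\<in>{..1::nat}. a 0 * a 1 * R * (s / 2))"
        by (simp only:) (rule sum.mono_neutral_cong_right, auto simp: N_def)
      then show ?thesis by simp
    qed
    ultimately have "(cmod (poly p (of_real R)))\<^sup>2 - (cmod (poly p (of_real R * v)))\<^sup>2 - a 0 * a 1 * R * s
        = (\<Sum>j\<le>N. \<Sum>k\<le>N. T j k - U j k)"
      by (simp add: sum_subtractf)
    also have "\<bar>\<dots>\<bar> \<le> (\<Sum>j\<le>N. \<Sum>k\<le>N. \<bar>a j * a k\<bar> * (real (j + k))\<^sup>2 * (R\<^sup>2 * s))"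
    proof (intro order_trans[OF sum_abs] sum_mono)
      fix j k :: nat
      consider "j + k = 1" | "j = k" "j + k \<noteq> 1" | "j + k \<ge> 2" by linarith
      then show "\<bar>T j k - U j k\<bar> \<le> \<bar>a j * a k\<bar> * (real (j + k))\<^sup>2 * (R\<^sup>2 * s)"
      proof cases
        case 1
        then have "j = 0 \<and> k = 1 \<or> j = 1 \<and> k = 0" by linarith
        then have "T j k = U j k"
          unfolding T_def U_def s_def using norm_minus_commute[of v 1] by fastforce
        then show ?thesis by (simp add: s_def)
      next
        case 2
        then have "T j k = 0" "U j k = 0" by (auto simp: T_def U_def)
        then show ?thesis by (simp add: s_def)
      next
        case 3
        then have U0: "U j k = 0" by (simp add: U_def)
        have "(cmod (v ^ j - v ^ k))\<^sup>2 \<le> (real (j + k))\<^sup>2 * s"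
          using power_mono[OF norm_power_diff_powers[OF v, of j k], of 2]
          by (simp add: s_def power_mult_distrib)
        then have "(cmod (v ^ j - v ^ k))\<^sup>2 / 2 \<le> (real (j + k))\<^sup>2 * s"
          using zero_le_power2[of "cmod (v ^ j - v ^ k)"] by linarith
        moreover have "R ^ (j + k) \<le> R\<^sup>2"
          using 3 R by (intro power_decreasing) auto
        ultimately have "R ^ (j + k) * ((cmod (v ^ j - v ^ k))\<^sup>2 / 2) \<le> R\<^sup>2 * ((real (j + k))\<^sup>2 * s)"
          using R by (intro mult_mono) auto
        then have "\<bar>a j * a k\<bar> * (R ^ (j + k) * ((cmod (v ^ j - v ^ k))\<^sup>2 / 2))
           \<le> \<bar>a j * a k\<bar> * (R\<^sup>2 * ((real (j + k))\<^sup>2 * s))"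
          by (intro mult_left_mono) auto
        then show ?thesis
          unfolding U0 T_def using R by (simp add: abs_mult mult.assoc mult.left_commute)
      qed
    qed
    also have "\<dots> = C * R\<^sup>2 * s"
      by (simp add: C_def sum_distrib_right mult.assoc)
    finally show ?thesis by (simp add: s_def)
  qed
  then show ?thesis unfolding a_def by blast
qed

text \<open>The hypothesis on the coefficients says that \<open>G = p / q\<close> satisfies \<open>G'(0) / G(0) > 0\<close>, cleared of
  denominators.  Cross-multiplying, the claim is that
  \<open>|p(R)|\<^sup>2 |q(u)|\<^sup>2 - |p(u)|\<^sup>2 |q(R)|\<^sup>2\<close> is nonnegative, and by the expansions of
  \<open>p\<close> and \<open>q\<close> it is at least \<open>R |v - 1|\<^sup>2\<close> times a function of \<open>R\<close> alone that is continuous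
  and positive at \<open>R = 0\<close>.  Zeros of \<open>q\<close> at \<open>u\<close> do no harm, since the quotient is then \<open>0\<close>.\<close>

lemma rational_max_at_positive_point:
  assumes p: "real_coeffs p" and q: "real_coeffs q"
    and pos: "0 < Re (coeff p 0) * Re (coeff q 0) *
      (Re (coeff p 1) * Re (coeff q 0) - Re (coeff p 0) * Re (coeff q 1))"
  shows "\<exists>\<delta>>0. \<forall>u. cmod u < \<delta> \<longrightarrow>
    cmod (poly p u / poly q u) \<le> cmod (poly p (of_real (cmod u)) / poly q (of_real (cmod u)))"
proof -
  obtain C where C: "\<And>R v. 0 \<le> R \<Longrightarrow> R \<le> 1 \<Longrightarrow> cmod v = 1 \<Longrightarrow>
    \<bar>(cmod (poly p (of_real R)))\<^sup>2 - (cmod (poly p (of_real R * v)))\<^sup>2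
      - Re (coeff p 0) * Re (coeff p 1) * R * (cmod (v - 1))\<^sup>2\<bar> \<le> C * R\<^sup>2 * (cmod (v - 1))\<^sup>2"
    using norm_poly_circle_expansion[OF p] by blast
  obtain D where D: "\<And>R v. 0 \<le> R \<Longrightarrow> R \<le> 1 \<Longrightarrow> cmod v = 1 \<Longrightarrow>
    \<bar>(cmod (poly q (of_real R)))\<^sup>2 - (cmod (poly q (of_real R * v)))\<^sup>2
      - Re (coeff q 0) * Re (coeff q 1) * R * (cmod (v - 1))\<^sup>2\<bar> \<le> D * R\<^sup>2 * (cmod (v - 1))\<^sup>2"
    using norm_poly_circle_expansion[OF q] by blast
  define a0 a1 b0 b1 where ab: "a0 = Re (coeff p 0)" "a1 = Re (coeff p 1)"
    "b0 = Re (coeff q 0)" "b1 = Re (coeff q 1)"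
  define h where "h R = (cmod (poly q (of_real R)))\<^sup>2 * (a0 * a1 - C * R)
     - (cmod (poly p (of_real R)))\<^sup>2 * (b0 * b1 + D * R)" for R
  have "isCont h 0" "isCont (\<lambda>R::real. cmod (poly q (of_real R))) 0"
    unfolding h_def by (intro continuous_intros)+
  then have lim: "(h \<longlongrightarrow> h 0) (at 0)"
    "((\<lambda>R::real. cmod (poly q (of_real R))) \<longlongrightarrow> cmod (poly q (of_real 0))) (at 0)"
    by (simp_all add: isCont_def)
  have c0: "cmod (coeff p 0) = \<bar>a0\<bar>" "cmod (coeff q 0) = \<bar>b0\<bar>"
    using p q by (simp_all add: real_coeffs_def ab in_Reals_norm)
  have "h 0 = a0 * b0 * (a1 * b0 - a0 * b1)"
    by (simp add: h_def poly_0_coeff_0 c0 power2_eq_square algebra_simps)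
  then have "h 0 > 0" using pos by (simp add: ab)
  moreover have "cmod (poly q (of_real 0)) > 0"
    using pos c0 by (auto simp: poly_0_coeff_0 ab)
  ultimately have "eventually (\<lambda>R. h R > 0 \<and> cmod (poly q (of_real R)) > 0) (at (0::real))"
    using order_tendstoD(1)[OF lim(1)] order_tendstoD(1)[OF lim(2)] unfolding eventually_conj_iff by blast
  then obtain d where d: "d > 0" "\<And>R. R \<noteq> 0 \<Longrightarrow> \<bar>R\<bar> < d \<Longrightarrow> h R > 0 \<and> cmod (poly q (of_real R)) > 0"
    unfolding eventually_at by (auto simp: dist_real_def)
  have "cmod (poly p u / poly q u) \<le> cmod (poly p (of_real (cmod u)) / poly q (of_real (cmod u)))"
    if u: "cmod u < min d 1" for u
  proof (cases "u = 0 \<or> poly q u = 0")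
    case False
    define R where "R = cmod u"
    define v where "v = u / of_real R"
    define s where "s = (cmod (v - 1))\<^sup>2"
    have R: "0 < R" "R \<le> 1" "R < d" using False u by (auto simp: R_def)
    have v: "cmod v = 1" using R by (simp add: v_def norm_divide R_def)
    have uv: "u = of_real R * v" using R by (simp add: v_def)
    have hq: "h R > 0" "cmod (poly q (of_real R)) > 0" using d(2)[of R] R by auto
    define A B A' B' where AB: "A = (cmod (poly p (of_real R)))\<^sup>2" "B = (cmod (poly q (of_real R)))\<^sup>2"
       "A' = (cmod (poly p u))\<^sup>2" "B' = (cmod (poly q u))\<^sup>2"
    have "A - A' \<ge> R * s * (a0 * a1 - C * R)"
      using C[of R v] R v by (simp add: AB uv s_def ab power2_eq_square algebra_simps abs_le_iff)
    then have 1: "B * (A - A') \<ge> B * (R * s * (a0 * a1 - C * R))"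
      by (rule mult_left_mono) (simp add: AB)
    have "B - B' \<le> R * s * (b0 * b1 + D * R)"
      using D[of R v] R v by (simp add: AB uv s_def ab power2_eq_square algebra_simps abs_le_iff)
    then have 2: "A * (B - B') \<le> A * (R * s * (b0 * b1 + D * R))"
      by (rule mult_left_mono) (simp add: AB)
    have "A * B' - A' * B \<ge> R * s * h R"
      using 1 2 unfolding h_def AB(1,2)[symmetric] by (simp add: algebra_simps)
    moreover have "R * s * h R \<ge> 0" using R hq by (simp add: s_def)
    ultimately have "A' * B \<le> A * B'" by linarith
    then have "(cmod (poly p u) * cmod (poly q (of_real R)))\<^sup>2 \<le> (cmod (poly p (of_real R)) * cmod (poly q u))\<^sup>2"
      by (simp add: AB power_mult_distrib)
    then have "cmod (poly p u) * cmod (poly q (of_real R)) \<le> cmod (poly p (of_real R)) * cmod (poly q u)"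
      by (rule power2_le_imp_le) simp
    then show ?thesis
      using False hq by (simp add: norm_divide field_simps flip: R_def)
  qed auto
  then show ?thesis using d(1) by (intro exI[of _ "min d 1"]) auto
qed

section \<open>Maxima on ellipses\<close>

text \<open>The unimodular factor \<open>\<sigma>\<close> selects the direction in which the maximum lies: \<open>\<sigma> = 1\<close> for the real axis,
  and \<open>\<sigma> = -1\<close> with \<open>d = 2\<close> for the imaginary axis.\<close>

lemma ellipse_max_of_rational:
  assumes p: "real_coeffs p" and q: "real_coeffs q"
    and pos: "0 < Re (coeff p 0) * Re (coeff q 0) *
      (Re (coeff p 1) * Re (coeff q 0) - Re (coeff p 0) * Re (coeff q 1))"
    and d: "d \<ge> 1" and \<sigma>: "cmod \<sigma> = 1" and c: "\<And>\<rho>. \<rho> > 1 \<Longrightarrow> c \<rho> \<ge> 0"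
    and g: "\<And>\<zeta>. cmod \<zeta> > 1 \<Longrightarrow> cmod (g ((\<zeta> + inverse \<zeta>) / 2)) =
       c (cmod \<zeta>) * cmod (poly p (\<sigma> * inverse \<zeta> ^ d) / poly q (\<sigma> * inverse \<zeta> ^ d))"
  shows "\<exists>\<rho>s>(1::real). \<forall>\<rho>>\<rho>s. \<forall>\<zeta>. cmod \<zeta> = \<rho> \<longrightarrow> \<sigma> * inverse \<zeta> ^ d = of_real (inverse \<rho> ^ d) \<longrightarrow>
    is_arg_max (\<lambda>z. cmod (g z)) (\<lambda>z. z \<in> ellipse \<rho>) ((\<zeta> + inverse \<zeta>) / 2) \<and>
    ellipse_norm \<rho> g = cmod (g ((\<zeta> + inverse \<zeta>) / 2))"
proof -
  obtain \<delta> where \<delta>: "\<delta> > 0" "\<And>u. cmod u < \<delta> \<Longrightarrow>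
    cmod (poly p u / poly q u) \<le> cmod (poly p (of_real (cmod u)) / poly q (of_real (cmod u)))"
    using rational_max_at_positive_point[OF p q pos] by blast
  show ?thesis
  proof (intro exI[of _ "1 + 1 / \<delta>"] conjI allI impI)
    \<comment> \<open>The summand \<open>1\<close> makes the bound exceed \<open>1\<close>; then \<open>\<rho> > 1 / \<delta>\<close> gives \<open>\<rho>\<^sup>-\<^sup>d \<le> \<rho>\<^sup>-\<^sup>1 < \<delta>\<close>.\<close>
    show "1 < 1 + 1 / \<delta>" using \<delta> by simp
  next
    fix \<rho> \<zeta> assume \<rho>: "1 + 1 / \<delta> < \<rho>" and \<zeta>: "cmod \<zeta> = \<rho>" "\<sigma> * inverse \<zeta> ^ d = of_real (inverse \<rho> ^ d)"
    have "1 / \<delta> > 0" using \<delta> by simp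
    then have r1: "\<rho> > 1" "\<rho> > 1 / \<delta>" using \<rho> by linarith+
    have "inverse \<rho> ^ d \<le> inverse \<rho> ^ 1"
      using r1 d by (intro power_decreasing) (auto simp: inverse_le_1_iff)
    also have "\<dots> < \<delta>" using r1 \<delta> by (simp add: field_simps)
    finally have small: "inverse \<rho> ^ d < \<delta>" .
    have max: "cmod (g z) \<le> cmod (g ((\<zeta> + inverse \<zeta>) / 2))" if z: "z \<in> ellipse \<rho>" for z
    proof -
      obtain \<xi> where \<xi>: "cmod \<xi> = \<rho>" "z = (\<xi> + inverse \<xi>) / 2"
        using z by (auto simp: ellipse_def)
      have n: "cmod (\<sigma> * inverse \<xi> ^ d) = inverse \<rho> ^ d"
        using \<sigma> \<xi> by (simp add: norm_mult norm_power norm_inverse)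
      show ?thesis
        unfolding \<xi>(2) using g[of \<xi>] g[of \<zeta>] \<xi>(1) \<zeta> r1 c[of \<rho>] \<delta>(2)[of "\<sigma> * inverse \<xi> ^ d"] n small
        by (simp add: mult_left_mono)
    qed
    have mem: "(\<zeta> + inverse \<zeta>) / 2 \<in> ellipse \<rho>" using \<zeta> by (auto simp: ellipse_def)
    show "is_arg_max (\<lambda>z. cmod (g z)) (\<lambda>z. z \<in> ellipse \<rho>) ((\<zeta> + inverse \<zeta>) / 2)"
      using max mem by (auto simp: is_arg_max_def not_less)
    show "ellipse_norm \<rho> g = cmod (g ((\<zeta> + inverse \<zeta>) / 2))"
      unfolding ellipse_norm_def using max mem by (intro cSup_eq_maximum) auto
  qed
qed

text \<open>When the modulus depends on \<open>\<zeta>\<^sup>-\<^sup>2\<close>, the parameters \<open>\<rho>\<close> and \<open>-\<rho>\<close> both give the positive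
  argument, and therefore both real vertices are maximal.\<close>

lemma even_kernel_max_on_real_axis:
  assumes p: "real_coeffs p" and q: "real_coeffs q"
    and pos: "0 < Re (coeff p 0) * Re (coeff q 0) *
      (Re (coeff p 1) * Re (coeff q 0) - Re (coeff p 0) * Re (coeff q 1))"
    and c: "\<And>\<rho>. \<rho> > 1 \<Longrightarrow> c \<rho> \<ge> 0"
    and g: "\<And>\<zeta>. cmod \<zeta> > 1 \<Longrightarrow> cmod (g ((\<zeta> + inverse \<zeta>) / 2)) =
       c (cmod \<zeta>) * cmod (poly p (inverse \<zeta> ^ 2) / poly q (inverse \<zeta> ^ 2))"
  shows "\<exists>\<rho>s>(1::real). \<forall>\<rho>::real. \<rho> > \<rho>s \<longrightarrow>
            attains_max_on_real_axis \<rho> g \<and>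
            ellipse_norm \<rho> g = cmod (g (- (of_real (\<rho> + inverse \<rho>) / 2))) \<and>
            ellipse_norm \<rho> g = cmod (g (of_real (\<rho> + inverse \<rho>) / 2))"
proof -
  obtain \<rho>s where s: "\<rho>s > 1" and *: "\<And>\<rho> \<zeta>. \<rho> > \<rho>s \<Longrightarrow> cmod \<zeta> = \<rho> \<Longrightarrow> 1 * inverse \<zeta> ^ 2 = of_real (inverse \<rho> ^ 2) \<Longrightarrow>
    is_arg_max (\<lambda>z. cmod (g z)) (\<lambda>z. z \<in> ellipse \<rho>) ((\<zeta> + inverse \<zeta>) / 2) \<and>
    ellipse_norm \<rho> g = cmod (g ((\<zeta> + inverse \<zeta>) / 2))"
    using ellipse_max_of_rational[OF p q pos, of 2 1 c g] c g by auto
  have right: "is_arg_max (\<lambda>z. cmod (g z)) (\<lambda>z. z \<in> ellipse \<rho>) (of_real (\<rho> + inverse \<rho>) / 2) \<and>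
      ellipse_norm \<rho> g = cmod (g (of_real (\<rho> + inverse \<rho>) / 2))" if "\<rho> > \<rho>s" for \<rho>
    using *[of \<rho> "of_real \<rho>"] that s by simp
  have left: "ellipse_norm \<rho> g = cmod (g (- (of_real (\<rho> + inverse \<rho>) / 2)))" if "\<rho> > \<rho>s" for \<rho>
  proof -
    have "- (of_real (\<rho> + inverse \<rho>) / 2) = (- complex_of_real \<rho> + inverse (- complex_of_real \<rho>)) / 2"
      by (simp add: field_simps)
    then show ?thesis using *[of \<rho> "- of_real \<rho>"] that s by (simp only:) simp
  qed
  have "complex_of_real (\<rho> + inverse \<rho>) / 2 \<in> \<real>" for \<rho> by (intro Reals_divide Reals_of_real Reals_numeral)
  then show ?thesis
    using s left right unfolding attains_max_on_real_axis_def by blast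
qed

section \<open>The kernels as rational functions of the inverse parameter\<close>

lemma diff_inverse_factor:
  fixes z :: complex
  assumes "z \<noteq> 0"
  shows "z - inverse z = z * (1 - inverse z ^ 2)"
  using assms by (simp add: field_simps power2_eq_square)

lemma power_add_powi_factor:
  fixes z :: complex
  assumes "z \<noteq> 0"
  shows "z ^ n + z powi (- int n) = z ^ n * (1 + (inverse z ^ 2) ^ n)"
proof -
  have "(inverse z ^ 2) ^ n = inverse (z ^ n) * inverse (z ^ n)"
    by (simp add: power2_eq_square power_mult_distrib power_inverse)
  then show ?thesis using assms by (simp add: power_int_minus field_simps)
qed

text \<open>In each of the following identities the highest power of \<open>\<zeta>\<close> is taken out of every factor;
  the moduli of these powers form the constant, and what remains is a polynomial
  in \<open>\<zeta>\<^sup>-\<^sup>2\<close> or \<open>\<zeta>\<^sup>-\<^sup>1\<close> with nonzero constant term.\<close>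

lemma K_1_norm_eq_rational:
  assumes "cmod \<zeta> > 1"
  shows "cmod (K_1 n ((\<zeta> + inverse \<zeta>) / 2)) =
    pi * cmod \<zeta> ^ (2*n) / (2 ^ (2*n-2) * cmod \<zeta> ^ (3*n) * cmod \<zeta> * cmod \<zeta> ^ n) *
      cmod (poly ([:3:] + monom 1 n) (inverse \<zeta> ^ 2) / poly ([:1,-1:] * (1 + monom 1 n)) (inverse \<zeta> ^ 2))"
proof -
  have nz: "\<zeta> \<noteq> 0" using assms by auto
  have N: "3 * \<zeta> ^ (2*n) + 1 = \<zeta> ^ (2*n) * (3 + (inverse \<zeta> ^ 2) ^ n)"
  proof -
    have "\<zeta> ^ (2*n) * (inverse \<zeta> ^ 2) ^ n = 1"
      using nz by (simp add: power_mult power_inverse)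
    then show ?thesis by (simp add: distrib_left)
  qed
  have p: "poly ([:3:] + monom 1 n) (inverse \<zeta> ^ 2) = 3 + (inverse \<zeta> ^ 2) ^ n"
    unfolding poly_mult by (simp add: poly_monom)
  have q: "poly ([:1,-1:] * (1 + monom 1 n)) (inverse \<zeta> ^ 2) = (1 - inverse \<zeta> ^ 2) * (1 + (inverse \<zeta> ^ 2) ^ n)"
    unfolding poly_mult by (simp add: poly_monom)
  show ?thesis
    unfolding K_1_def zeta_of_eq[OF assms] Let_def diff_inverse_factor[OF nz] power_add_powi_factor[OF nz] N p q
    by (simp add: norm_mult norm_divide norm_power mult_ac)
qed

lemma K_2_norm_eq_rational:
  assumes "cmod \<zeta> > 1"
  shows "cmod (K_2 n ((\<zeta> + inverse \<zeta>) / 2)) =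
    pi * cmod \<zeta> ^ (2*n+2) / (2 ^ (2*n) * cmod \<zeta> ^ (3*n+2) * cmod \<zeta> * cmod \<zeta> ^ n) *
      cmod (poly ([:2,-1:] - monom 1 (n+1)) (inverse \<zeta> ^ 2) / poly ([:1,-1:] * (1 + monom 1 n)) (inverse \<zeta> ^ 2))"
proof -
  have nz: "\<zeta> \<noteq> 0" using assms by auto
  have N: "2 * \<zeta> ^ (2*n+2) - \<zeta> ^ (2*n) - 1
      = \<zeta> ^ (2*n+2) * (2 - inverse \<zeta> ^ 2 - (inverse \<zeta> ^ 2) ^ (n+1))"
    using nz by (simp add: power_mult power_add power2_eq_square field_simps)
  have p: "poly ([:2,-1:] - monom 1 (n+1)) (inverse \<zeta> ^ 2) = 2 - inverse \<zeta> ^ 2 - (inverse \<zeta> ^ 2) ^ (n+1)"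
    unfolding poly_mult by (simp add: poly_monom)
  have q: "poly ([:1,-1:] * (1 + monom 1 n)) (inverse \<zeta> ^ 2) = (1 - inverse \<zeta> ^ 2) * (1 + (inverse \<zeta> ^ 2) ^ n)"
    unfolding poly_mult by (simp add: poly_monom)
  show ?thesis
    unfolding K_2_def zeta_of_eq[OF assms] Let_def diff_inverse_factor[OF nz] power_add_powi_factor[OF nz] N p q
    by (simp add: norm_mult norm_divide norm_power mult_ac del: power_Suc)
qed

lemma K_3_norm_eq_rational:
  assumes "cmod \<zeta> > 1"
  shows "cmod (K_3 n ((\<zeta> + inverse \<zeta>) / 2)) =
    pi * cmod \<zeta> ^ (2*n+1) / (2 ^ (2*n) * cmod \<zeta> ^ (3*n+1) * cmod \<zeta> * cmod \<zeta> ^ n) *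
      cmod (poly ([:2,1:] + monom 1 (2*n+1)) (inverse \<zeta>) / poly ([:1,0,-1:] * (1 + monom 1 (2*n))) (inverse \<zeta>))"
proof -
  have nz: "\<zeta> \<noteq> 0" using assms by auto
  have N: "2 * \<zeta> ^ (2*n+1) + \<zeta> ^ (2*n) + 1
      = \<zeta> ^ (2*n+1) * (2 + inverse \<zeta> + inverse \<zeta> ^ (2*n+1))"
    using nz by (simp add: power_mult power_add power2_eq_square field_simps)
  have p: "poly ([:2,1:] + monom 1 (2*n+1)) (inverse \<zeta>) = 2 + inverse \<zeta> + inverse \<zeta> ^ (2*n+1)"
    by (simp add: poly_monom)
  have q: "poly ([:1,0,-1:] * (1 + monom 1 (2*n))) (inverse \<zeta>) = (1 - inverse \<zeta> ^ 2) * (1 + (inverse \<zeta> ^ 2) ^ n)"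
    unfolding poly_mult by (simp add: poly_monom power_mult power2_eq_square)
  show ?thesis
    unfolding K_3_def zeta_of_eq[OF assms] Let_def diff_inverse_factor[OF nz] power_add_powi_factor[OF nz] N p q
    by (simp add: norm_mult norm_divide norm_power mult_ac del: power_Suc)
qed

text \<open>Taking \<open>\<zeta>\<^sup>m\<close> out of \<open>1 + (-1)\<^sup>k \<zeta>\<^sup>m\<close> leaves \<open>(-1)\<^sup>k + \<zeta>\<^sup>-\<^sup>m\<close>; taking out the sign as well, which does not
  change the modulus, makes the constant term \<open>1\<close>.\<close>

lemma K_I_even_norm_eq_rational:
  assumes "cmod \<zeta> > 1" and m: "m = 2 * k"
  shows "cmod (K_I m ((\<zeta> + inverse \<zeta>) / 2)) =
    pi * (cmod \<zeta> ^ 4 * cmod \<zeta> ^ m) / (cmod \<zeta> ^ 2 * cmod \<zeta> * cmod \<zeta> ^ (2*m+2)) *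
      cmod (poly ([:1,1:] * [:1,1:] * (1 + monom ((-1)^k) k)) (inverse \<zeta> ^ 2)
        / poly ([:1,-1:] * (1 + monom 1 (m+1))) (inverse \<zeta> ^ 2))"
proof -
  have nz: "\<zeta> \<noteq> 0" using assms by auto
  have 1: "(\<zeta>^2 + 1)^2 = \<zeta> ^ 4 * ((1 + inverse \<zeta> ^ 2) * (1 + inverse \<zeta> ^ 2))"
    using nz by (simp add: field_simps power2_eq_square eval_nat_numeral)
  have 2: "1 + (-1)^k * \<zeta>^m = (-1) ^ k * (\<zeta> ^ m * (1 + (-1) ^ k * (inverse \<zeta> ^ 2) ^ k))"
  proof -
    have "\<zeta> ^ m * (inverse \<zeta> ^ 2) ^ k = 1"
      using nz by (simp add: m power_mult power_inverse)
    then show ?thesis by (cases "even k") (simp_all add: distrib_left right_diff_distrib)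
  qed
  have 3: "\<zeta> ^ (2*m+2) + 1 = \<zeta> ^ (2*m+2) * (1 + (inverse \<zeta> ^ 2) ^ (m+1))"
    using nz by (simp add: power_mult power_add power2_eq_square field_simps)
  have p: "poly ([:1,1:] * [:1,1:] * (1 + monom ((-1)^k) k)) (inverse \<zeta> ^ 2)
      = (1 + inverse \<zeta> ^ 2) * (1 + inverse \<zeta> ^ 2) * (1 + (-1) ^ k * (inverse \<zeta> ^ 2) ^ k)"
    unfolding poly_mult by (simp add: poly_monom)
  have q: "poly ([:1,-1:] * (1 + monom 1 (m+1))) (inverse \<zeta> ^ 2) = (1 - inverse \<zeta> ^ 2) * (1 + (inverse \<zeta> ^ 2) ^ (m+1))"
    unfolding poly_mult by (simp add: poly_monom)
  have k: "m div 2 = k" "even m" using m by auto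
  show ?thesis
    unfolding K_I_def zeta_of_eq[OF assms(1)] Let_def diff_inverse_factor[OF nz] k(1) 1 2 3 p q
    by (simp add: k norm_mult norm_divide norm_power mult_ac del: power_Suc)
qed

text \<open>The two alternating sums in the denominator of \<open>K_I\<close> for odd \<open>m\<close>, divided by \<open>\<zeta>\<^sup>m\<close> and expressed in \<open>\<zeta>\<^sup>-\<^sup>2\<close>.\<close>

definition odd_kernel_poly :: "nat \<Rightarrow> complex poly" where
  "odd_kernel_poly m = (\<Sum>j=0..(m-1) div 2. smult ((-1)^j * of_nat (m-2*j)) (monom 1 j + monom 1 (m-j)))"

text \<open>For \<open>m \<ge> 3\<close> only the first family of monomials reaches degree at most 1, with \<open>j = 1\<close> contributing
  \<open>-(m - 2)\<close>.  For \<open>m = 1\<close> the polynomial is \<open>1 + u\<close>, where the linear term comes from the second family;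
  the same formula happens to hold.\<close>

lemma odd_kernel_poly_coeffs:
  assumes "odd m"
  shows "coeff (odd_kernel_poly m) 0 = of_nat m" "coeff (odd_kernel_poly m) 1 = 2 - of_nat m"
proof -
  have "coeff (odd_kernel_poly m) 0 = (\<Sum>j=0..(m-1) div 2. if j = 0 then of_nat m else 0)"
    unfolding odd_kernel_poly_def coeff_sum using assms
    by (intro sum.cong refl) (auto elim!: oddE)
  then show "coeff (odd_kernel_poly m) 0 = of_nat m" by simp
  show "coeff (odd_kernel_poly m) 1 = 2 - of_nat m"
  proof (cases "m = 1")
    case True
    then show ?thesis by (simp add: odd_kernel_poly_def)
  next
    case False
    then have m: "m \<ge> 3" using assms by (auto elim!: oddE)
    then have "coeff (odd_kernel_poly m) 1 = (\<Sum>j=0..(m-1) div 2. if j = 1 then 2 - of_nat m else 0)"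
      unfolding odd_kernel_poly_def coeff_sum using assms
      by (intro sum.cong refl) (auto simp: of_nat_diff)
    moreover have "1 \<le> (m-1) div 2" using m by simp
    ultimately show ?thesis by simp
  qed
qed

lemma real_coeffs_odd_kernel_poly: "real_coeffs (odd_kernel_poly m)"
  unfolding odd_kernel_poly_def by (intro real_coeffs_intros) simp_all

lemma odd_kernel_sum_factor:
  assumes nz: "\<zeta> \<noteq> (0::complex)" and m: "odd m"
  shows "(\<Sum>j=0..(m-1) div 2. (-1)^j * of_nat (m-2*j) * \<zeta>^(m-2*j))
      + (\<Sum>j=0..(m-1) div 2. (-1)^j * of_nat (m-2*j) * \<zeta> powi (2 * int j - int m))
    = \<zeta> ^ m * poly (odd_kernel_poly m) (inverse \<zeta> ^ 2)"
proof -
  have "(-1)^j * of_nat (m-2*j) * \<zeta>^(m-2*j) + (-1)^j * of_nat (m-2*j) * \<zeta> powi (2 * int j - int m)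
     = \<zeta> ^ m * poly (smult ((-1)^j * of_nat (m-2*j)) (monom 1 j + monom 1 (m-j))) (inverse \<zeta> ^ 2)"
    if j: "j \<in> {0..(m-1) div 2}" for j
  proof -
    have jm: "2 * j < m" using j m by (auto elim!: oddE)
    have "\<zeta> ^ (m - 2*j) = \<zeta> ^ m * (inverse \<zeta> ^ 2) ^ j"
      using nz jm by (simp add: power_diff power_mult[symmetric] field_simps)
    moreover have "\<zeta> powi (2 * int j - int m) = \<zeta> ^ m * (inverse \<zeta> ^ 2) ^ (m - j)"
    proof -
      have "(inverse \<zeta> ^ 2) ^ (m - j) = inverse (\<zeta> ^ (2 * (m - j)))"
        by (simp add: power_mult power_inverse)
      then have "\<zeta> ^ m * (inverse \<zeta> ^ 2) ^ (m - j) = \<zeta> powi (int m) * \<zeta> powi (- int (2 * (m - j)))"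
        by (simp only: power_int_minus power_int_of_nat)
      also have "\<dots> = \<zeta> powi (int m + - int (2 * (m - j)))"
        using nz by (subst power_int_add) simp_all
      also have "int m + - int (2 * (m - j)) = 2 * int j - int m" using jm by simp
      finally show ?thesis by simp
    qed
    ultimately show ?thesis by (simp add: poly_monom algebra_simps)
  qed
  then show ?thesis
    unfolding odd_kernel_poly_def poly_sum sum_distrib_left sum.distrib[symmetric]
    by (intro sum.cong refl)
qed

lemma K_I_odd_norm_eq_rational:
  assumes "cmod \<zeta> > 1" and m: "odd m"
  shows "cmod (K_I m ((\<zeta> + inverse \<zeta>) / 2)) =
    pi * cmod \<zeta> ^ 2 / (cmod \<zeta> ^ (m+2) * cmod \<zeta> * cmod \<zeta> ^ m) *
      cmod (poly [:of_nat (m+2), of_nat m:] (inverse \<zeta> ^ 2)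
        / poly ([:1,-1:] * odd_kernel_poly m) (inverse \<zeta> ^ 2))"
proof -
  have nz: "\<zeta> \<noteq> 0" using assms by auto
  have p: "poly [:of_nat (m+2), of_nat m:] (inverse \<zeta> ^ 2) = of_nat (m+2) + inverse \<zeta> ^ 2 * of_nat m"
    by simp
  have q: "poly ([:1,-1:] * odd_kernel_poly m) (inverse \<zeta> ^ 2)
      = (1 - inverse \<zeta> ^ 2) * poly (odd_kernel_poly m) (inverse \<zeta> ^ 2)"
    unfolding poly_mult by simp
  have 1: "of_nat (m+2) * \<zeta>^2 + of_nat m = \<zeta>^2 * (of_nat (m+2) + inverse \<zeta> ^ 2 * of_nat m)"
    using nz by (simp add: field_simps)
  show ?thesis
    unfolding K_I_def zeta_of_eq[OF assms(1)] Let_def diff_inverse_factor[OF nz] 1 odd_kernel_sum_factor[OF nz m] p q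
    using m by (simp add: norm_mult norm_divide norm_power mult_ac del: power_Suc of_nat_add)
qed

section \<open>Location of the maxima\<close>

theorem theorem3p1:
  shows "(\<forall>m::nat. m \<ge> 1 \<longrightarrow> (\<exists>\<rho>s>(1::real). \<forall>\<rho>::real. \<rho> > \<rho>s \<longrightarrow>
            attains_max_on_real_axis \<rho> (K_I m) \<and>
            ellipse_norm \<rho> (K_I m) = cmod (K_I m (- (of_real (\<rho> + inverse \<rho>) / 2))) \<and>
            ellipse_norm \<rho> (K_I m) = cmod (K_I m (of_real (\<rho> + inverse \<rho>) / 2))))
       \<and> (\<forall>n::nat. n > 1 \<longrightarrow> (\<exists>\<rho>s>(1::real). \<forall>\<rho>::real. \<rho> > \<rho>s \<longrightarrow>
            attains_max_on_real_axis \<rho> (K_1 n) \<and>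
            ellipse_norm \<rho> (K_1 n) = cmod (K_1 n (- (of_real (\<rho> + inverse \<rho>) / 2))) \<and>
            ellipse_norm \<rho> (K_1 n) = cmod (K_1 n (of_real (\<rho> + inverse \<rho>) / 2))))
       \<and> (\<forall>n::nat. n > 1 \<longrightarrow> (\<exists>\<rho>s>(1::real). \<forall>\<rho>::real. \<rho> > \<rho>s \<longrightarrow>
            attains_max_on_real_axis \<rho> (K_2 n) \<and>
            ellipse_norm \<rho> (K_2 n) = cmod (K_2 n (- (of_real (\<rho> + inverse \<rho>) / 2))) \<and>
            ellipse_norm \<rho> (K_2 n) = cmod (K_2 n (of_real (\<rho> + inverse \<rho>) / 2))))
       \<and> (\<exists>\<rho>s>(1::real). \<forall>\<rho>::real. \<rho> > \<rho>s \<longrightarrow>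
            attains_max_on_imaginary_axis \<rho> (K_2 1) \<and>
            ellipse_norm \<rho> (K_2 1) = cmod (K_2 1 (\<i> / 2 * of_real (\<rho> - inverse \<rho>))))
       \<and> (\<forall>n::nat. n \<ge> 1 \<longrightarrow> (\<exists>\<rho>s>(1::real). \<forall>\<rho>::real. \<rho> > \<rho>s \<longrightarrow>
            attains_max_on_real_axis \<rho> (K_3 n) \<and>
            ellipse_norm \<rho> (K_3 n) = cmod (K_3 n (of_real (\<rho> + inverse \<rho>) / 2))))"
proof (intro conjI allI impI)
  fix m :: nat assume m: "m \<ge> 1"
  show "\<exists>\<rho>s>(1::real). \<forall>\<rho>::real. \<rho> > \<rho>s \<longrightarrow>
            attains_max_on_real_axis \<rho> (K_I m) \<and>
            ellipse_norm \<rho> (K_I m) = cmod (K_I m (- (of_real (\<rho> + inverse \<rho>) / 2))) \<and>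
            ellipse_norm \<rho> (K_I m) = cmod (K_I m (of_real (\<rho> + inverse \<rho>) / 2))"
  proof (cases "even m")
    case True
    then obtain k where k: "m = 2 * k" by (rule evenE)
    show ?thesis
      using m k
      by (intro even_kernel_max_on_real_axis[OF _ _ _ _ K_I_even_norm_eq_rational[OF _ k]] real_coeffs_intros)
        (auto simp: coeff_mult coeff_1 power_Suc)
  next
    case False
    show ?thesis
    proof (rule even_kernel_max_on_real_axis[OF _ _ _ _ K_I_odd_norm_eq_rational[OF _ False]])
      have "(real m + 2) * real m * (real m * real m - (real m + 2) * (2 - 2 * real m)) > 0"
      proof (intro mult_pos_pos)
        have "real m * real m \<ge> 1 * 1" using m by (intro mult_mono) auto
        then show "real m * real m - (real m + 2) * (2 - 2 * real m) > 0"
          using m by (simp add: algebra_simps)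
      qed (use m in auto)
      then show "0 < Re (coeff [:of_nat (m+2), of_nat m:] 0) * Re (coeff ([:1,-1:] * odd_kernel_poly m) 0) *
        (Re (coeff [:of_nat (m+2), of_nat m:] 1) * Re (coeff ([:1,-1:] * odd_kernel_poly m) 0)
         - Re (coeff [:of_nat (m+2), of_nat m:] 0) * Re (coeff ([:1,-1:] * odd_kernel_poly m) 1))"
        using False by (simp add: coeff_mult odd_kernel_poly_coeffs[unfolded One_nat_def] algebra_simps)
    next
      show "real_coeffs ([:1,-1:] * odd_kernel_poly m)"
        by (intro real_coeffs_mult real_coeffs_odd_kernel_poly) simp
    qed auto
  qed
next
  fix n :: nat assume n: "n > 1"
  show "\<exists>\<rho>s>(1::real). \<forall>\<rho>::real. \<rho> > \<rho>s \<longrightarrow>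
            attains_max_on_real_axis \<rho> (K_1 n) \<and>
            ellipse_norm \<rho> (K_1 n) = cmod (K_1 n (- (of_real (\<rho> + inverse \<rho>) / 2))) \<and>
            ellipse_norm \<rho> (K_1 n) = cmod (K_1 n (of_real (\<rho> + inverse \<rho>) / 2))"
    using n by (intro even_kernel_max_on_real_axis[OF _ _ _ _ K_1_norm_eq_rational] real_coeffs_intros)
      (auto simp: coeff_mult coeff_1)
next
  fix n :: nat assume n: "n > 1"
  show "\<exists>\<rho>s>(1::real). \<forall>\<rho>::real. \<rho> > \<rho>s \<longrightarrow>
            attains_max_on_real_axis \<rho> (K_2 n) \<and>
            ellipse_norm \<rho> (K_2 n) = cmod (K_2 n (- (of_real (\<rho> + inverse \<rho>) / 2))) \<and>
            ellipse_norm \<rho> (K_2 n) = cmod (K_2 n (of_real (\<rho> + inverse \<rho>) / 2))"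
    using n by (intro even_kernel_max_on_real_axis[OF _ _ _ _ K_2_norm_eq_rational] real_coeffs_intros)
      (auto simp: coeff_mult coeff_1)
next
  \<comment> \<open>The numerator \<open>2 - u - u\<^sup>2\<close> and the denominator \<open>(1 - u) (1 + u)\<close> of \<open>K_2 1\<close>, as polynomials in \<open>-u\<close>:
     the sign change makes the first-order coefficient of the quotient positive.\<close>
  define p q :: "complex poly" where "p = [:2,1,-1:]" and "q = [:1,0,-1:]"
  have "\<exists>\<rho>s>(1::real). \<forall>\<rho>>\<rho>s. \<forall>\<zeta>. cmod \<zeta> = \<rho> \<longrightarrow> (-1) * inverse \<zeta> ^ 2 = of_real (inverse \<rho> ^ 2) \<longrightarrow>
    is_arg_max (\<lambda>z. cmod (K_2 1 z)) (\<lambda>z. z \<in> ellipse \<rho>) ((\<zeta> + inverse \<zeta>) / 2) \<and>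
    ellipse_norm \<rho> (K_2 1) = cmod (K_2 1 ((\<zeta> + inverse \<zeta>) / 2))"
  proof (rule ellipse_max_of_rational[of p q])
    fix \<zeta> :: complex assume z: "cmod \<zeta> > 1"
    have "poly ([:2,-1:] - monom 1 (1+1)) (inverse \<zeta> ^ 2) = poly p (-1 * inverse \<zeta> ^ 2)"
         "poly ([:1,-1:] * (1 + monom 1 1)) (inverse \<zeta> ^ 2) = poly q (-1 * inverse \<zeta> ^ 2)"
      by (simp_all add: p_def q_def poly_monom algebra_simps power2_eq_square)
    then show "cmod (K_2 1 ((\<zeta> + inverse \<zeta>) / 2)) =
        pi * cmod \<zeta> ^ (2*1+2) / (2 ^ (2*1) * cmod \<zeta> ^ (3*1+2) * cmod \<zeta> * cmod \<zeta> ^ 1) *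
        cmod (poly p (-1 * inverse \<zeta> ^ 2) / poly q (-1 * inverse \<zeta> ^ 2))"
      using K_2_norm_eq_rational[OF z, of 1] by metis
  qed (auto simp: p_def q_def)
  then obtain \<rho>s where s: "\<rho>s > 1" and *: "\<And>\<rho> \<zeta>. \<rho> > \<rho>s \<Longrightarrow> cmod \<zeta> = \<rho> \<Longrightarrow>
      (-1) * inverse \<zeta> ^ 2 = of_real (inverse \<rho> ^ 2) \<Longrightarrow>
    is_arg_max (\<lambda>z. cmod (K_2 1 z)) (\<lambda>z. z \<in> ellipse \<rho>) ((\<zeta> + inverse \<zeta>) / 2) \<and>
    ellipse_norm \<rho> (K_2 1) = cmod (K_2 1 ((\<zeta> + inverse \<zeta>) / 2))"
    by blast
  show "\<exists>\<rho>s>(1::real). \<forall>\<rho>::real. \<rho> > \<rho>s \<longrightarrow>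
            attains_max_on_imaginary_axis \<rho> (K_2 1) \<and>
            ellipse_norm \<rho> (K_2 1) = cmod (K_2 1 (\<i> / 2 * of_real (\<rho> - inverse \<rho>)))"
  proof (intro exI[of _ \<rho>s] conjI[OF s] allI impI)
    fix \<rho> assume \<rho>: "\<rho> > \<rho>s"
    define \<zeta> where "\<zeta> = \<i> * complex_of_real \<rho>"
    have pt: "(\<zeta> + inverse \<zeta>) / 2 = \<i> / 2 * of_real (\<rho> - inverse \<rho>)"
      using \<rho> s by (simp add: \<zeta>_def field_simps)
    have "cmod \<zeta> = \<rho>" "(-1) * inverse \<zeta> ^ 2 = of_real (inverse \<rho> ^ 2)"
      using \<rho> s by (simp_all add: \<zeta>_def norm_mult power_mult_distrib)
    from *[OF \<rho> this] show "attains_max_on_imaginary_axis \<rho> (K_2 1) \<and>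
            ellipse_norm \<rho> (K_2 1) = cmod (K_2 1 (\<i> / 2 * of_real (\<rho> - inverse \<rho>)))"
      unfolding pt attains_max_on_imaginary_axis_def
      by (intro conjI exI[of _ "\<i> / 2 * of_real (\<rho> - inverse \<rho>)"]) simp_all
  qed
next
  fix n :: nat assume n: "n \<ge> 1"
  define p q :: "complex poly" where "p = [:2,1:] + monom 1 (2*n+1)" and "q = [:1,0,-1:] * (1 + monom 1 (2*n))"
  have "\<exists>\<rho>s>(1::real). \<forall>\<rho>>\<rho>s. \<forall>\<zeta>. cmod \<zeta> = \<rho> \<longrightarrow> 1 * inverse \<zeta> ^ 1 = of_real (inverse \<rho> ^ 1) \<longrightarrow>
    is_arg_max (\<lambda>z. cmod (K_3 n z)) (\<lambda>z. z \<in> ellipse \<rho>) ((\<zeta> + inverse \<zeta>) / 2) \<and>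
    ellipse_norm \<rho> (K_3 n) = cmod (K_3 n ((\<zeta> + inverse \<zeta>) / 2))"
  proof (rule ellipse_max_of_rational[of p q])
    fix \<zeta> :: complex assume z: "cmod \<zeta> > 1"
    show "cmod (K_3 n ((\<zeta> + inverse \<zeta>) / 2)) =
        pi * cmod \<zeta> ^ (2*n+1) / (2 ^ (2*n) * cmod \<zeta> ^ (3*n+1) * cmod \<zeta> * cmod \<zeta> ^ n) *
        cmod (poly p (1 * inverse \<zeta> ^ 1) / poly q (1 * inverse \<zeta> ^ 1))"
      using K_3_norm_eq_rational[OF z, of n] by (simp only: p_def q_def power_one_right mult_1_left)
  next
    show "real_coeffs p" "real_coeffs q"
      unfolding p_def q_def by (intro real_coeffs_intros; simp)+
  qed (use n in \<open>auto simp: p_def q_def coeff_mult coeff_1\<close>)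
  then obtain \<rho>s where s: "\<rho>s > 1" and *: "\<And>\<rho> \<zeta>. \<rho> > \<rho>s \<Longrightarrow> cmod \<zeta> = \<rho> \<Longrightarrow>
      1 * inverse \<zeta> ^ 1 = of_real (inverse \<rho> ^ 1) \<Longrightarrow>
    is_arg_max (\<lambda>z. cmod (K_3 n z)) (\<lambda>z. z \<in> ellipse \<rho>) ((\<zeta> + inverse \<zeta>) / 2) \<and>
    ellipse_norm \<rho> (K_3 n) = cmod (K_3 n ((\<zeta> + inverse \<zeta>) / 2))"
    by blast
  show "\<exists>\<rho>s>(1::real). \<forall>\<rho>::real. \<rho> > \<rho>s \<longrightarrow>
            attains_max_on_real_axis \<rho> (K_3 n) \<and>
            ellipse_norm \<rho> (K_3 n) = cmod (K_3 n (of_real (\<rho> + inverse \<rho>) / 2))"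
  proof (intro exI[of _ \<rho>s] conjI[OF s] allI impI)
    fix \<rho> assume \<rho>: "\<rho> > \<rho>s"
    have real: "complex_of_real (\<rho> + inverse \<rho>) / 2 \<in> \<real>"
      by (intro Reals_divide Reals_of_real Reals_numeral)
    have max: "is_arg_max (\<lambda>z. cmod (K_3 n z)) (\<lambda>z. z \<in> ellipse \<rho>) (of_real (\<rho> + inverse \<rho>) / 2) \<and>
      ellipse_norm \<rho> (K_3 n) = cmod (K_3 n (of_real (\<rho> + inverse \<rho>) / 2))"
      using *[OF \<rho>, of "of_real \<rho>"] \<rho> s by simp
    show "attains_max_on_real_axis \<rho> (K_3 n) \<and>
            ellipse_norm \<rho> (K_3 n) = cmod (K_3 n (of_real (\<rho> + inverse \<rho>) / 2))"
      unfolding attains_max_on_real_axis_def using max real by blast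
  qed
qed

end
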